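(* Let $X$ be a shift space on a finite alphabet $A$ with a shift-invariant probability measure $\mu$, and let $\varphi\colon A^*\to G$ be a (monoid) morphism onto a finite group $G$. For every group language $L=\varphi^{-1}(K)$, where $K\subseteq G$, the density $\delta_\mu(L)$ exists. Moreover, if $\mu$ is ergodic, the density is given by $$\delta_\mu(L)=\sum_{g\in G}\bar\mu(\{g\}\times X)\,\bar\mu(gK\times X),$$ where $\bar\mu$ is any ergodic measure on the skew product $G\rtimes_\varphi X$ that projects to $\mu$.
   Context: A shift space on a finite alphabet $A$ is a nonempty closed subset $X\subseteq A^{\mathbb Z}$ invariant under the shift map $S((x_n)_n)=(x_{n+1})_n$, such that every letter of $A$ occurs in some element of $X$. Measures are Borel probability measures. For $x\in X$ and $i\le j$, $x_{[i,j)}=x_i x_{i+1}\cdots x_{j-1}$. For a language $L\subseteq A^*$, $[L\cap A^i]=\{x\in X: x_{[0,i)}\in L\}$, and the density of $L$ under $\mu$ is $\delta_\mu(L)=\lim_{n\to\infty}\frac1n\sum_{i=0}^{n-1}\mu([L\cap A^i])$ whenever this limit exists. The skew product $G\rtimes_\varphi X$ is the dynamical system $(G\times X,T_\varphi)$ with $G$ discrete and $T_\varphi(g,x)=(g\varphi(x_0),Sx)$. An ergodic measure on it is a $T_\varphi$-invariant ergodic Borel probability measure. A measure $\bar\mu$ on $G\rtimes_\varphi X$ projects to $\mu$ if $\bar\mu(G\times B)=\mu(B)$ for every measurable $B\subseteq X$. $gK=\{gk:k\in K\}$. *)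

theory Defs
  imports "HOL-Probability.Probability" "HOL-Algebra.Coset"
begin

definition borel_prob :: "'p topology \<Rightarrow> 'p measure \<Rightarrow> bool" where
  "borel_prob T M \<longleftrightarrow> prob_space M \<and> sets M = sets (sigma (topspace T) {U. openin T U})"

definition invariant_prob :: "'p topology \<Rightarrow> ('p \<Rightarrow> 'p) \<Rightarrow> 'p measure \<Rightarrow> bool" where
  "invariant_prob T f M \<longleftrightarrow> borel_prob T M \<and> f \<in> measurable M M \<and>
     (\<forall>B\<in>sets M. measure M (f -` B \<inter> space M) = measure M B)"

definition ergodic_prob :: "'p topology \<Rightarrow> ('p \<Rightarrow> 'p) \<Rightarrow> 'p measure \<Rightarrow> bool" where
  "ergodic_prob T f M \<longleftrightarrow> invariant_prob T f M \<and>
     (\<forall>B\<in>sets M. f -` B \<inter> space M = B \<longrightarrow> measure M B = 0 \<or> measure M B = 1)"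

definition shift :: "(int \<Rightarrow> 'a) \<Rightarrow> int \<Rightarrow> 'a" where
  "shift x = (\<lambda>n. x (n + 1))"

definition full_shift :: "'a set \<Rightarrow> (int \<Rightarrow> 'a) topology" where
  "full_shift A = product_topology (\<lambda>_. discrete_topology A) UNIV"

text \<open>The carrier of \<^term>\<open>full_shift A\<close> consists of all bi-infinite sequences with values in
  \<open>A\<close>. Shifts being invertible on it, invariance is \<open>S(X) = X\<close>.\<close>

definition shift_space :: "'a set \<Rightarrow> (int \<Rightarrow> 'a) set \<Rightarrow> bool" where
  "shift_space A X \<longleftrightarrow> X \<noteq> {} \<and> closedin (full_shift A) X \<and> shift ` X = X \<and>
     (\<forall>a\<in>A. \<exists>x\<in>X. \<exists>n. x n = a)"

definition shift_topology :: "'a set \<Rightarrow> (int \<Rightarrow> 'a) set \<Rightarrow> (int \<Rightarrow> 'a) topology" where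
  "shift_topology A X = subtopology (full_shift A) X"

definition factor :: "(int \<Rightarrow> 'a) \<Rightarrow> int \<Rightarrow> int \<Rightarrow> 'a list" where
  "factor x i j = map x [i..j - 1]"

text \<open>The set \<open>[L \<inter> A\<^sup>i]\<close>.\<close>

definition lang_cylinder :: "(int \<Rightarrow> 'a) set \<Rightarrow> 'a list set \<Rightarrow> nat \<Rightarrow> (int \<Rightarrow> 'a) set" where
  "lang_cylinder X L i = {x \<in> X. factor x 0 (int i) \<in> L}"

definition density_seq ::
    "(int \<Rightarrow> 'a) set \<Rightarrow> (int \<Rightarrow> 'a) measure \<Rightarrow> 'a list set \<Rightarrow> nat \<Rightarrow> real" where
  "density_seq X \<mu> L n = (1 / real n) * (\<Sum>i<n. measure \<mu> (lang_cylinder X L i))"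

definition density_exists ::
    "(int \<Rightarrow> 'a) set \<Rightarrow> (int \<Rightarrow> 'a) measure \<Rightarrow> 'a list set \<Rightarrow> bool" where
  "density_exists X \<mu> L \<longleftrightarrow> convergent (density_seq X \<mu> L)"

definition lang_density ::
    "(int \<Rightarrow> 'a) set \<Rightarrow> (int \<Rightarrow> 'a) measure \<Rightarrow> 'a list set \<Rightarrow> real" where
  "lang_density X \<mu> L = lim (density_seq X \<mu> L)"

definition word_monoid :: "'a set \<Rightarrow> 'a list monoid" where
  "word_monoid A = \<lparr>carrier = lists A, monoid.mult = (@), one = []\<rparr>"

definition group_language :: "'a set \<Rightarrow> ('a list \<Rightarrow> 'g) \<Rightarrow> 'g set \<Rightarrow> 'a list set" where
  "group_language A \<phi> K = {w \<in> lists A. \<phi> w \<in> K}"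

definition skew_topology ::
    "('g, 'm) monoid_scheme \<Rightarrow> 'a set \<Rightarrow> (int \<Rightarrow> 'a) set \<Rightarrow> ('g \<times> (int \<Rightarrow> 'a)) topology" where
  "skew_topology G A X = prod_topology (discrete_topology (carrier G)) (shift_topology A X)"

definition skew_map ::
    "('g, 'm) monoid_scheme \<Rightarrow> ('a list \<Rightarrow> 'g) \<Rightarrow> 'g \<times> (int \<Rightarrow> 'a) \<Rightarrow> 'g \<times> (int \<Rightarrow> 'a)" where
  "skew_map G \<phi> = (\<lambda>(g, x). (g \<otimes>\<^bsub>G\<^esub> \<phi> [x 0], shift x))"

definition projects_to ::
    "('g, 'm) monoid_scheme \<Rightarrow> ('g \<times> (int \<Rightarrow> 'a)) measure \<Rightarrow> (int \<Rightarrow> 'a) measure \<Rightarrow> bool" where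
  "projects_to G \<nu> \<mu> \<longleftrightarrow> (\<forall>B\<in>sets \<mu>. measure \<nu> (carrier G \<times> B) = measure \<mu> B)"

end

theory Submission imports Defs begin

text \<open>
  Write \<open>T\<close> for the skew product map. Since \<open>T\<^sup>i (g, x) = (g \<phi>(x\<^sub>0 \<dots> x\<^sub>i\<^sub>-\<^sub>1), S\<^sup>i x)\<close>, the slice
  of \<open>[L \<inter> A\<^sup>i]\<close> over \<open>g\<close> is \<open>{g} \<times> X \<inter> T\<^sup>-\<^sup>i (gK \<times> X)\<close>, so the density is a Cesaro limit of
  correlations. Such limits exist for every finite invariant measure by Birkhoff's theorem for
  bounded functions and dominated convergence; applied to counting measure times \<open>\<mu>\<close>
  with \<open>g = 1\<close> this gives existence. For an ergodic lift of \<open>\<mu>\<close> the correlations tend to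
  products of measures, and summing over \<open>g\<close> gives the formula. Birkhoff's theorem
  follows from Garsia's maximal inequality applied to the invariant sets on which the upper
  average exceeds a given rational.
\<close>

section \<open>Orbit sums and Garsia's maximal inequality\<close>

locale measure_preserving = finite_measure M for M :: "'p measure" +
  fixes T :: "'p \<Rightarrow> 'p"
  assumes T_measurable [measurable]: "T \<in> M \<rightarrow>\<^sub>M M"
    and distr_T: "distr M M T = M"
begin

lemma funpow_measurable [measurable]: "T ^^ i \<in> M \<rightarrow>\<^sub>M M"
  by (induction i) (auto intro!: measurable_comp[OF _ T_measurable])

lemma funpow_in_space: "x \<in> space M \<Longrightarrow> (T ^^ i) x \<in> space M"
  using measurable_space[OF funpow_measurable] .

lemma integral_T:
  fixes f :: "'p \<Rightarrow> real"
  assumes [measurable]: "f \<in> borel_measurable M"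
  shows "(\<integral>x. f (T x) \<partial>M) = integral\<^sup>L M f"
  by (subst (2) distr_T[symmetric]) (simp add: integral_distr)

lemma integrable_T:
  fixes f :: "'p \<Rightarrow> real"
  assumes "integrable M f"
  shows "integrable M (\<lambda>x. f (T x))"
  by (rule integrable_distr[OF T_measurable]) (simp add: distr_T assms)

definition orbit_sum :: "('p \<Rightarrow> real) \<Rightarrow> nat \<Rightarrow> 'p \<Rightarrow> real" where
  "orbit_sum f n x = (\<Sum>i<n. f ((T ^^ i) x))"

lemma orbit_sum_0 [simp]: "orbit_sum f 0 x = 0"
  by (simp add: orbit_sum_def)

lemma orbit_sum_Suc: "orbit_sum f (Suc n) x = f x + orbit_sum f n (T x)"
  by (simp only: orbit_sum_def sum.lessThan_Suc_shift funpow_Suc_right o_apply funpow_0)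

lemma orbit_sum_measurable [measurable]:
  "f \<in> borel_measurable M \<Longrightarrow> orbit_sum f n \<in> borel_measurable M"
  unfolding orbit_sum_def
  by (intro borel_measurable_sum measurable_compose[OF funpow_measurable])

text \<open>The running maximum of the orbit sums of lengths \<open>0, \<dots>, n\<close>, in the recursive form
  on which Garsia's proof of the maximal ergodic theorem rests.\<close>

fun orbit_max :: "('p \<Rightarrow> real) \<Rightarrow> nat \<Rightarrow> 'p \<Rightarrow> real" where
  "orbit_max f 0 x = 0"
| "orbit_max f (Suc n) x = max 0 (f x + orbit_max f n (T x))"

lemma orbit_max_nonneg: "0 \<le> orbit_max f n x"
  by (cases n) auto

lemma orbit_sum_le_max: "orbit_sum f n x \<le> orbit_max f n x"
  by (induction n arbitrary: x) (auto simp: orbit_sum_Suc le_max_iff_disj)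

lemma orbit_max_Suc_mono: "orbit_max f n x \<le> orbit_max f (Suc n) x"
  by (induction n arbitrary: x) (auto simp: max.coboundedI2 intro!: max.mono)

lemma orbit_max_mono: "m \<le> n \<Longrightarrow> orbit_max f m x \<le> orbit_max f n x"
  by (rule lift_Suc_mono_le[of "\<lambda>n. orbit_max f n x"]) (rule orbit_max_Suc_mono)

lemma integrable_orbit_max:
  assumes "integrable M f"
  shows "integrable M (orbit_max f n)"
proof (induction n)
  case (Suc n)
  have "integrable M (\<lambda>x. max 0 (f x + orbit_max f n (T x)))"
    using assms integrable_T[OF Suc] by auto
  then show ?case by (simp add: fun_eq_iff cong: integrable_cong)
qed (simp cong: integrable_cong)

text \<open>Where the maximum of index \<open>Suc n\<close> is positive, it equals
  \<open>f x + orbit_max f n (T x)\<close>; elsewhere it is 0 and subtracting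
  \<open>orbit_max f n (T x)\<close> only lowers it. Hence the difference of the two is at most
  \<open>f\<close> on the positivity set and at most 0 off it. Its integral is nonnegative because
  the maxima increase with \<open>n\<close> and \<open>T\<close> preserves integrals.\<close>

lemma maximal_ergodic:
  assumes f: "integrable M f"
  shows "0 \<le> (\<integral>x. f x * indicator {x. 0 < orbit_max f (Suc n) x} x \<partial>M)"
proof -
  note [measurable] = borel_measurable_integrable[OF integrable_orbit_max[OF f]]
    borel_measurable_integrable[OF f]
  have "0 \<le> (\<integral>x. orbit_max f (Suc n) x - orbit_max f n x \<partial>M)"
    by (intro integral_nonneg_AE AE_I2) (metis diff_ge_0_iff_ge orbit_max_Suc_mono)
  also have "\<dots> = (\<integral>x. orbit_max f (Suc n) x \<partial>M) - (\<integral>x. orbit_max f n x \<partial>M)"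
    by (rule Bochner_Integration.integral_diff) (rule integrable_orbit_max[OF f])+
  also have "\<dots> = (\<integral>x. orbit_max f (Suc n) x \<partial>M) - (\<integral>x. orbit_max f n (T x) \<partial>M)"
    by (subst integral_T) auto
  also have "\<dots> = (\<integral>x. orbit_max f (Suc n) x - orbit_max f n (T x) \<partial>M)"
    by (rule Bochner_Integration.integral_diff[symmetric])
      (intro integrable_T integrable_orbit_max[OF f])+
  also have "\<dots> \<le> (\<integral>x. f x * indicator {x. 0 < orbit_max f (Suc n) x} x \<partial>M)"
  proof (rule integral_mono)
    show "integrable M (\<lambda>x. orbit_max f (Suc n) x - orbit_max f n (T x))"
      by (intro Bochner_Integration.integrable_diff integrable_T integrable_orbit_max[OF f])
    \<comment> \<open>Measurability is available only inside \<open>space M\<close>, so the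
      positivity set is first cut down to it; both indicators agree there.\<close>
    have "{x \<in> space M. 0 < orbit_max f (Suc n) x} \<in> sets M" by measurable
    then have "integrable M (\<lambda>x. f x * indicator {x \<in> space M. 0 < orbit_max f (Suc n) x} x)"
      using f by (rule integrable_real_mult_indicator)
    then show "integrable M (\<lambda>x. f x * indicator {x. 0 < orbit_max f (Suc n) x} x)"
      by (rule Bochner_Integration.integrable_cong[THEN iffD1, OF refl, rotated]) (auto simp: indicator_def)
    show "orbit_max f (Suc n) x - orbit_max f n (T x)
        \<le> f x * indicator {x. 0 < orbit_max f (Suc n) x} x" for x
      using orbit_max_nonneg[of f n "T x"] by (auto simp: indicator_def)
  qed
  finally show ?thesis .
qed

lemma invariant_funpow_iff:
  assumes "T -` E \<inter> space M = E" and "x \<in> space M"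
  shows "(T ^^ i) x \<in> E \<longleftrightarrow> x \<in> E"
proof (induction i)
  case (Suc i)
  then show ?case using assms funpow_in_space[of x i] by auto
qed simp

text \<open>The maximal inequality is applied to \<open>f - b\<close> cut off outside
  \<open>E\<close>. An orbit starting in \<open>E\<close> stays there and one starting outside never
  enters, so on \<open>E\<close> the cut-off function has the orbit sums of \<open>f - b\<close>,
  and off \<open>E\<close> it vanishes. By \<open>pos\<close> the positivity sets exhaust
  \<open>E\<close> as the length grows, and dominated convergence turns the inequality into one over
  all of \<open>E\<close>.\<close>

lemma maximal_ergodic_invariant_set:
  assumes f: "integrable M f"
    and E [measurable]: "E \<in> sets M" and inv: "T -` E \<inter> space M = E"
    and pos: "\<And>x. x \<in> E \<Longrightarrow> \<exists>n. orbit_sum f n x > b * real n"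
  shows "b * measure M E \<le> (\<integral>x. f x * indicator E x \<partial>M)"
proof -
  define h where "h = (\<lambda>x. (f x - b) * indicator E x)"
  have h: "integrable M h"
    unfolding h_def by (intro integrable_real_mult_indicator E) (auto intro: f)
  note [measurable] = borel_measurable_integrable[OF integrable_orbit_max[OF h]]
    borel_measurable_integrable[OF h]
  have sum_h: "orbit_sum h n x = orbit_sum f n x - b * real n" if "x \<in> E" for n x
  proof -
    have "x \<in> space M" using that E sets.sets_into_space by blast
    then have "h ((T ^^ i) x) = f ((T ^^ i) x) - b" for i
      using invariant_funpow_iff[OF inv] that by (simp add: h_def)
    then show ?thesis by (simp add: orbit_sum_def sum_subtractf)
  qed
  have lim: "(\<lambda>n. h x * indicator {x. 0 < orbit_max h (Suc n) x} x) \<longlonglongrightarrow> h x"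
    if "x \<in> space M" for x
  proof (cases "x \<in> E")
    case True
    then obtain k where "orbit_sum h k x > 0" using pos[OF True] by (auto simp: sum_h)
    then have k: "orbit_max h k x > 0" using orbit_sum_le_max[of h k x] by linarith
    \<comment> \<open>The running maximum never decreases, so once positive at \<open>k\<close> it
      stays positive and the indicator is 1 from there on.\<close>
    have "eventually (\<lambda>n. h x * indicator {x. 0 < orbit_max h (Suc n) x} x = h x) sequentially"
    proof (rule eventually_sequentiallyI[of k])
      fix n assume "k \<le> n"
      then have "orbit_max h k x \<le> orbit_max h (Suc n) x" by (intro orbit_max_mono) simp
      then have "0 < orbit_max h (Suc n) x" using k by linarith
      then show "h x * indicator {x. 0 < orbit_max h (Suc n) x} x = h x"
        by (simp add: indicator_def del: orbit_max.simps)
    qed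
    then show ?thesis by (rule tendsto_eventually)
  next
    case False
    then show ?thesis by (simp add: h_def)
  qed
  have "(\<lambda>n. \<integral>x. h x * indicator {x. 0 < orbit_max h (Suc n) x} x \<partial>M) \<longlonglongrightarrow> integral\<^sup>L M h"
    by (rule integral_dominated_convergence[where w="\<lambda>x. \<bar>h x\<bar>"])
      (use h lim in \<open>auto simp: indicator_def simp del: orbit_max.simps\<close>)
  then have "0 \<le> integral\<^sup>L M h"
    by (rule LIMSEQ_le_const) (use maximal_ergodic[OF h] in auto)
  also have "integral\<^sup>L M h = (\<integral>x. f x * indicator E x - b * indicator E x \<partial>M)"
    by (simp add: h_def algebra_simps)
  also have "\<dots> = (\<integral>x. f x * indicator E x \<partial>M) - b * measure M E"
    by (subst Bochner_Integration.integral_diff)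
      (auto intro!: integrable_real_mult_indicator f simp: emeasure_finite less_top[symmetric])
  finally show ?thesis by simp
qed

section \<open>Birkhoff's theorem for bounded functions\<close>

definition orbit_avg :: "('p \<Rightarrow> real) \<Rightarrow> nat \<Rightarrow> 'p \<Rightarrow> real" where
  "orbit_avg f n x = orbit_sum f n x / real n"

lemma orbit_avg_measurable [measurable]:
  "f \<in> borel_measurable M \<Longrightarrow> orbit_avg f n \<in> borel_measurable M"
  unfolding orbit_avg_def
  by (intro borel_measurable_divide orbit_sum_measurable borel_measurable_const)

lemma orbit_avg_uminus: "orbit_avg (\<lambda>x. - f x) n x = - orbit_avg f n x"
  by (simp add: orbit_avg_def orbit_sum_def sum_negf)

lemma orbit_avg_bounded:
  assumes "\<And>x. \<bar>f x\<bar> \<le> C"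
  shows "\<bar>orbit_avg f n x\<bar> \<le> C"
proof (cases n)
  \<comment> \<open>Division by zero makes the average 0 here, and \<open>C\<close> is nonnegative
    because it bounds an absolute value.\<close>
  case 0
  then show ?thesis using assms[of x] by (simp add: orbit_avg_def)
next
  case (Suc m)
  have "\<bar>orbit_sum f n x\<bar> \<le> (\<Sum>i<n. \<bar>f ((T ^^ i) x)\<bar>)" unfolding orbit_sum_def by (rule sum_abs)
  also have "\<dots> \<le> real n * C" using assms sum_mono[of "{..<n}" "\<lambda>i. \<bar>f ((T ^^ i) x)\<bar>" "\<lambda>_. C"] by simp
  finally show ?thesis using Suc by (simp add: orbit_avg_def field_simps)
qed

text \<open>Values in \<open>ereal\<close> let the limsup exist at every point, so that
  measurability can be stated without a bound on \<open>f\<close>.\<close>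

definition upper_avg :: "('p \<Rightarrow> real) \<Rightarrow> 'p \<Rightarrow> ereal" where
  "upper_avg f x = limsup (\<lambda>n. ereal (orbit_avg f n x))"

lemma upper_avg_measurable [measurable]:
  assumes [measurable]: "f \<in> borel_measurable M"
  shows "upper_avg f \<in> borel_measurable M"
  unfolding upper_avg_def by measurable

text \<open>Moving the starting point one step along the orbit drops the first term of the sum and
  adds one at the end. After division by \<open>n\<close> this boundary term is at most
  \<open>2 * C / n\<close> in absolute value. Level sets of \<open>upper_avg\<close> are therefore
  invariant.\<close>

lemma upper_avg_T:
  assumes bd: "\<And>x. \<bar>f x\<bar> \<le> C"
  shows "upper_avg f (T x) = upper_avg f x"
proof -
  have diff: "orbit_avg f n (T x) = (f ((T ^^ n) x) - f x) / real n + orbit_avg f n x" for n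
  proof -
    have "f x + orbit_sum f n (T x) = orbit_sum f n x + f ((T ^^ n) x)"
      using orbit_sum_Suc[of f n x] by (simp add: orbit_sum_def)
    then have "orbit_sum f n (T x) = f ((T ^^ n) x) - f x + orbit_sum f n x" by simp
    then show ?thesis by (simp only: orbit_avg_def add_divide_distrib)
  qed
  have "(\<lambda>n. (f ((T ^^ n) x) - f x) / real n) \<longlonglongrightarrow> 0"
  proof (rule Lim_null_comparison)
    show "eventually (\<lambda>n. norm ((f ((T ^^ n) x) - f x) / real n) \<le> 2 * C / real n) sequentially"
    proof (intro always_eventually allI)
      fix n
      have "\<bar>f ((T ^^ n) x) - f x\<bar> \<le> 2 * C" using bd[of x] bd[of "(T ^^ n) x"] by linarith
      then show "norm ((f ((T ^^ n) x) - f x) / real n) \<le> 2 * C / real n"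
        by (simp add: divide_right_mono)
    qed
    show "(\<lambda>n. 2 * C / real n) \<longlonglongrightarrow> 0" by (rule lim_const_over_n)
  qed
  then have "(\<lambda>n. ereal ((f ((T ^^ n) x) - f x) / real n)) \<longlonglongrightarrow> 0"
    by (simp add: zero_ereal_def)
  then have "limsup (\<lambda>n. ereal ((f ((T ^^ n) x) - f x) / real n) + ereal (orbit_avg f n x))
      = 0 + limsup (\<lambda>n. ereal (orbit_avg f n x))"
    by (intro ereal_limsup_lim_add) auto
  then show ?thesis by (simp add: upper_avg_def diff)
qed

lemma upper_avg_less_imp_orbit_sum:
  assumes "ereal b < upper_avg f x"
  shows "\<exists>n. orbit_sum f n x > b * real n"
proof (rule ccontr)
  assume "\<not> ?thesis"
  then have le: "orbit_sum f n x \<le> b * real n" for n by (simp add: not_less)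
  have "upper_avg f x \<le> ereal b" unfolding upper_avg_def
  \<comment> \<open>Index 0 is discarded: the average there is 0 by convention and may exceed
    \<open>b\<close>.\<close>
  proof (rule Limsup_bounded, rule eventually_sequentiallyI[of 1])
    fix n :: nat assume "1 \<le> n"
    then show "ereal (orbit_avg f n x) \<le> ereal b"
      using le[of n] by (simp add: orbit_avg_def field_simps)
  qed
  then show False using assms by simp
qed

lemma upper_avg_integral_bound:
  assumes f: "f \<in> borel_measurable M" and bd: "\<And>x. \<bar>f x\<bar> \<le> C"
    and E: "E \<in> sets M" "T -` E \<inter> space M = E"
    and b: "\<And>x. x \<in> E \<Longrightarrow> ereal b < upper_avg f x"
  shows "b * measure M E \<le> (\<integral>x. f x * indicator E x \<partial>M)"
proof (rule maximal_ergodic_invariant_set[OF _ E])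
  show "integrable M f" by (rule integrable_const_bound[where B=C]) (use f bd in auto)
qed (use b upper_avg_less_imp_orbit_sum in blast)

text \<open>The negated upper average of \<open>-f\<close> is the liminf of the averages of
  \<open>f\<close>, so the hypothesis says limsup is at most liminf. Boundedness makes their common
  value a real number.\<close>

lemma convergent_orbit_avgI:
  assumes bd: "\<And>x. \<bar>f x\<bar> \<le> C"
    and "upper_avg f x \<le> - upper_avg (\<lambda>x. - f x) x"
  shows "convergent (\<lambda>n. orbit_avg f n x)"
proof -
  let ?u = "\<lambda>n. ereal (orbit_avg f n x)"
  have neg: "- upper_avg (\<lambda>x. - f x) x = liminf ?u"
    unfolding upper_avg_def by (simp add: orbit_avg_uminus ereal_Limsup_uminus flip: uminus_ereal.simps(1))
  have "liminf ?u \<le> limsup ?u" by (rule Liminf_le_Limsup) simp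
  then have eq: "liminf ?u = limsup ?u" using assms(2) unfolding neg by (simp add: upper_avg_def)
  have "ereal (- C) \<le> ?u n" "?u n \<le> ereal C" for n
    using orbit_avg_bounded[of f C n x] bd by (auto simp: abs_le_iff minus_le_iff)
  then have "ereal (- C) \<le> liminf ?u" "limsup ?u \<le> ereal C"
    by (auto intro!: Liminf_bounded Limsup_bounded simp del: uminus_ereal.simps ereal_less_eq)
  then obtain l where l: "limsup ?u = ereal l" using eq by (cases "limsup ?u") auto
  have "?u \<longlonglongrightarrow> ereal l" using l eq by (intro Liminf_eq_Limsup) auto
  then show ?thesis by (auto simp: convergent_def)
qed

text \<open>Where the averages diverge, rationals \<open>a < b\<close> separate liminf from limsup.
  On the invariant set \<open>E\<close> with liminf below \<open>a\<close> and limsup above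
  \<open>b\<close>, the maximal inequality for \<open>f\<close> and for \<open>-f\<close> gives
  \<open>b * measure M E\<close> at most the integral of \<open>f\<close> over \<open>E\<close>,
  itself at most \<open>a * measure M E\<close>. So \<open>E\<close> is null, and there are only
  countably many pairs.\<close>

theorem birkhoff_convergent:
  assumes f [measurable]: "f \<in> borel_measurable M" and bd: "\<And>x. \<bar>f x\<bar> \<le> C"
  shows "AE x in M. convergent (\<lambda>n. orbit_avg f n x)"
proof -
  let ?U = "upper_avg f" and ?V = "upper_avg (\<lambda>x. - f x)"
  have bd': "\<And>x. \<bar>- f x\<bar> \<le> C" using bd by simp
  have null: "AE x in M. \<not> (ereal b < ?U x \<and> ereal (- a) < ?V x)" if "a < b" for a b :: real
  proof -
    define E where "E = {x \<in> space M. ereal b < ?U x \<and> ereal (- a) < ?V x}"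
    have E [measurable]: "E \<in> sets M" unfolding E_def by measurable
    have inv: "T -` E \<inter> space M = E"
      using measurable_space[OF T_measurable]
      by (auto simp: E_def upper_avg_T[of f, OF bd] upper_avg_T[of "\<lambda>x. - f x", OF bd'])
    have "b * measure M E \<le> (\<integral>x. f x * indicator E x \<partial>M)"
      by (rule upper_avg_integral_bound[OF f bd E inv]) (auto simp: E_def)
    moreover have "- a * measure M E \<le> (\<integral>x. - f x * indicator E x \<partial>M)"
      by (rule upper_avg_integral_bound[OF _ bd' E inv]) (auto simp: E_def)
    ultimately have "(b - a) * measure M E \<le> 0" by (simp add: algebra_simps)
    then have "measure M E = 0" using that measure_nonneg[of M E]
      by (simp add: mult_le_0_iff)
    then have "E \<in> null_sets M" by (simp add: emeasure_eq_measure null_setsI)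
    then show ?thesis by (rule AE_I'[of E]) (auto simp: E_def)
  qed
  have "AE x in M. \<forall>a\<in>\<rat>. \<forall>b\<in>\<rat>. a < b \<longrightarrow> \<not> (ereal b < ?U x \<and> ereal (- a) < ?V x)"
    using null by (auto simp: AE_ball_countable countable_rat)
  then show ?thesis
  proof eventually_elim
    case (elim x)
    have "?U x \<le> - ?V x"
    proof (rule ccontr)
      assume "\<not> ?thesis"
      then have "- ?V x < ?U x" by simp
      \<comment> \<open>A real \<open>c\<close> strictly inside the gap leaves room for a rational
        \<open>b\<close> above it and a rational \<open>a\<close> below it, which forces
        \<open>a < b\<close>.\<close>
      then obtain c where c: "- ?V x < ereal c" "ereal c < ?U x" using ereal_dense2 by blast
      then obtain b where "c < b" "b \<in> \<rat>" "ereal b < ?U x"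
      proof -
        obtain d where d: "ereal c < ereal d" "ereal d < ?U x" using ereal_dense2[OF c(2)] by blast
        obtain q where "q \<in> \<rat>" "c < q" "q < d" using Rats_dense_in_real[of c d] d by auto
        then show ?thesis using that[of q] d by (meson less_ereal.simps(1) less_trans)
      qed
      moreover obtain a where "a < c" "a \<in> \<rat>" "- ?V x < ereal a"
      proof -
        obtain d where d: "- ?V x < ereal d" "ereal d < ereal c" using ereal_dense2[OF c(1)] by blast
        obtain q where "q \<in> \<rat>" "d < q" "q < c" using Rats_dense_in_real[of d c] d by auto
        then show ?thesis using that[of q] d by (meson less_ereal.simps(1) less_trans)
      qed
      moreover have "ereal (- a) < ?V x"
        using calculation by (cases "?V x") auto
      ultimately show False using elim by (meson less_trans)
    qed
    then show ?case using convergent_orbit_avgI[of f C x] bd by blast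
  qed
qed

section \<open>Cesaro averages of correlations\<close>

definition correlation_avg :: "'p set \<Rightarrow> 'p set \<Rightarrow> nat \<Rightarrow> real" where
  "correlation_avg A B n = (\<Sum>i<n. measure M (A \<inter> ((T ^^ i) -` B \<inter> space M))) / real n"

lemma correlation_avg_eq_integral:
  assumes [measurable]: "A \<in> sets M" "B \<in> sets M"
  shows "correlation_avg A B n = (\<integral>x. indicator A x * orbit_avg (indicator B) n x \<partial>M)"
proof -
  have [measurable]: "(T ^^ i) -` B \<inter> space M \<in> sets M" for i
    by (rule measurable_sets[OF funpow_measurable assms(2)])
  have ind: "integrable M (\<lambda>x. indicator (A \<inter> ((T ^^ i) -` B \<inter> space M)) x :: real)" for i
    by (auto simp: emeasure_finite less_top[symmetric])
  have "(\<integral>x. indicator A x * orbit_avg (indicator B) n x \<partial>M)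
      = (\<integral>x. (\<Sum>i<n. indicator (A \<inter> ((T ^^ i) -` B \<inter> space M)) x) / real n \<partial>M)"
    by (rule Bochner_Integration.integral_cong)
      (auto simp: orbit_avg_def orbit_sum_def sum_divide_distrib indicator_def intro!: sum.cong)
  also have "\<dots> = (\<Sum>i<n. \<integral>x. indicator (A \<inter> ((T ^^ i) -` B \<inter> space M)) x \<partial>M) / real n"
    using ind by (simp add: Bochner_Integration.integral_sum)
  also have "\<dots> = correlation_avg A B n"
    by (simp add: correlation_avg_def Int_ac)
  finally show ?thesis ..
qed

text \<open>Averages of an indicator lie between 0 and 1, so the constant 1 dominates and the almost
  everywhere limit passes under the integral.\<close>

lemma correlation_avg_tendsto:
  assumes [measurable]: "A \<in> sets M" "B \<in> sets M" "l \<in> borel_measurable M"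
    and lim: "AE x in M. (\<lambda>n. orbit_avg (indicator B) n x) \<longlonglongrightarrow> l x"
  shows "correlation_avg A B \<longlonglongrightarrow> (\<integral>x. indicator A x * l x \<partial>M)"
  unfolding correlation_avg_eq_integral[OF assms(1,2), abs_def]
proof (rule integral_dominated_convergence[where w="\<lambda>_. 1"])
  show "AE x in M. (\<lambda>n. indicator A x * orbit_avg (indicator B) n x) \<longlonglongrightarrow> indicator A x * l x"
    using lim by eventually_elim (rule tendsto_mult_left)
  show "AE x in M. norm (indicator A x * orbit_avg (indicator B) n x) \<le> 1" for n
    using orbit_avg_bounded[of "indicator B" 1 n] by (auto simp: indicator_def)
qed auto

theorem correlation_avg_convergent:
  assumes A: "A \<in> sets M" and B [measurable]: "B \<in> sets M"
  shows "convergent (correlation_avg A B)"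
proof -
  have "AE x in M. convergent (\<lambda>n. orbit_avg (indicator B) n x)"
    by (rule birkhoff_convergent[where C=1]) (auto simp: indicator_def)
  \<comment> \<open>\<open>lim\<close> supplies a measurable limit function on the whole space; its
    values where the averages diverge only affect a null set.\<close>
  then have "AE x in M. (\<lambda>n. orbit_avg (indicator B) n x) \<longlonglongrightarrow> lim (\<lambda>n. orbit_avg (indicator B) n x)"
    by eventually_elim (simp add: convergent_LIMSEQ_iff)
  then show ?thesis
    by (intro convergentI[OF correlation_avg_tendsto[OF A B]]) auto
qed

end

section \<open>Ergodic systems: time averages equal space averages\<close>

locale ergodic_measure_preserving = measure_preserving M T + prob_space M
  for M :: "'p measure" and T +
  assumes ergodic: "E \<in> sets M \<Longrightarrow> T -` E \<inter> space M = E \<Longrightarrow> measure M E = 0 \<or> measure M E = 1"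
begin

text \<open>For \<open>b\<close> above the integral, the set where the upper average exceeds
  \<open>b\<close> is invariant, hence of measure 0 or 1. Measure 1 would turn the maximal
  inequality into \<open>b\<close> being at most the integral. Rational values of \<open>b\<close>
  suffice.\<close>

lemma upper_avg_le_integral:
  assumes f [measurable]: "f \<in> borel_measurable M" and bd: "\<And>x. \<bar>f x\<bar> \<le> C"
  shows "AE x in M. upper_avg f x \<le> ereal (integral\<^sup>L M f)"
proof -
  have null: "AE x in M. \<not> ereal b < upper_avg f x" if "integral\<^sup>L M f < b" for b
  proof -
    define E where "E = {x \<in> space M. ereal b < upper_avg f x}"
    have E [measurable]: "E \<in> sets M" unfolding E_def by measurable
    have inv: "T -` E \<inter> space M = E"
      using measurable_space[OF T_measurable] by (auto simp: E_def upper_avg_T[of f, OF bd])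
    have *: "b * measure M E \<le> (\<integral>x. f x * indicator E x \<partial>M)"
      by (rule upper_avg_integral_bound[OF f bd E inv]) (auto simp: E_def)
    have "measure M E \<noteq> 1"
    proof
      assume 1: "measure M E = 1"
      then have "AE x in M. x \<in> E" using prob_eq_1[OF E] by simp
      then have "(\<integral>x. f x * indicator E x \<partial>M) = integral\<^sup>L M f"
        by (intro integral_cong_AE) auto
      then show False using * 1 that by simp
    qed
    then have "measure M E = 0" using ergodic[OF E inv] by simp
    then have "E \<in> null_sets M" by (simp add: emeasure_eq_measure null_setsI)
    then show ?thesis by (rule AE_I'[of E]) (auto simp: E_def)
  qed
  have "AE x in M. \<forall>b\<in>\<rat>. integral\<^sup>L M f < b \<longrightarrow> \<not> ereal b < upper_avg f x"
    using null by (auto simp: AE_ball_countable countable_rat)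
  then show ?thesis
  proof eventually_elim
    case (elim x)
    show ?case
    proof (rule ccontr)
      assume "\<not> ?thesis"
      then obtain c where c: "integral\<^sup>L M f < c" "ereal c < upper_avg f x"
        using ereal_dense2[of "ereal (integral\<^sup>L M f)" "upper_avg f x"] by (auto simp: not_le)
      obtain q where q: "q \<in> \<rat>" "integral\<^sup>L M f < q" "q < c" using Rats_dense_in_real[OF c(1)] by auto
      then have "ereal q < upper_avg f x" using c(2) by (meson less_ereal.simps(1) less_trans)
      then show False using elim q by blast
    qed
  qed
qed

theorem birkhoff_ergodic:
  assumes f [measurable]: "f \<in> borel_measurable M" and bd: "\<And>x. \<bar>f x\<bar> \<le> C"
  shows "AE x in M. (\<lambda>n. orbit_avg f n x) \<longlonglongrightarrow> integral\<^sup>L M f"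
proof -
  have bd': "\<And>x. \<bar>- f x\<bar> \<le> C" using bd by simp
  have "AE x in M. upper_avg (\<lambda>x. - f x) x \<le> ereal (\<integral>x. - f x \<partial>M)"
    by (rule upper_avg_le_integral[OF _ bd']) simp
  with upper_avg_le_integral[OF f bd] birkhoff_convergent[OF f bd] show ?thesis
  proof eventually_elim
    case (elim x)
    then obtain l where l: "(\<lambda>n. orbit_avg f n x) \<longlonglongrightarrow> l" by (auto simp: convergent_def)
    \<comment> \<open>Convergence makes the two upper averages \<open>l\<close> and
      \<open>-l\<close>; their bounds then give both inequalities between \<open>l\<close> and the
      integral.\<close>
    then have "upper_avg f x = ereal l"
      unfolding upper_avg_def by (intro lim_imp_Limsup) auto
    moreover have "upper_avg (\<lambda>x. - f x) x = ereal (- l)"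
      unfolding upper_avg_def using tendsto_minus[OF l]
      by (intro lim_imp_Limsup) (auto simp: orbit_avg_uminus)
    ultimately have "l = integral\<^sup>L M f" using elim by simp
    then show ?case using l by simp
  qed
qed

theorem correlation_avg_ergodic:
  assumes A [measurable]: "A \<in> sets M" and B [measurable]: "B \<in> sets M"
  shows "correlation_avg A B \<longlonglongrightarrow> measure M A * measure M B"
proof -
  have "AE x in M. (\<lambda>n. orbit_avg (indicator B) n x) \<longlonglongrightarrow> integral\<^sup>L M (indicator B)"
    by (rule birkhoff_ergodic[where C=1]) (auto simp: indicator_def)
  from correlation_avg_tendsto[OF A B _ this] show ?thesis by simp
qed

end


section \<open>From Borel invariant measures to measure-preserving systems\<close>

lemma invariant_prob_measure_preserving:
  assumes "invariant_prob \<T> f M"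
  shows "measure_preserving M f"
proof -
  interpret prob_space M using assms by (simp add: invariant_prob_def borel_prob_def)
  have f [measurable]: "f \<in> M \<rightarrow>\<^sub>M M" using assms by (simp add: invariant_prob_def)
  have "distr M M f = M"
  proof (rule measure_eqI)
    fix B assume "B \<in> sets (distr M M f)"
    then show "emeasure (distr M M f) B = emeasure M B"
      using assms by (simp add: emeasure_distr emeasure_eq_measure invariant_prob_def)
  qed simp
  then show ?thesis by unfold_locales auto
qed

lemma ergodic_prob_ergodic_measure_preserving:
  assumes "ergodic_prob \<T> f M"
  shows "ergodic_measure_preserving M f"
proof -
  interpret measure_preserving M f
    using assms by (auto simp: ergodic_prob_def intro: invariant_prob_measure_preserving)
  interpret prob_space M
    using assms by (simp add: ergodic_prob_def invariant_prob_def borel_prob_def)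
  show ?thesis by unfold_locales (use assms in \<open>auto simp: ergodic_prob_def\<close>)
qed

lemma borel_prob_space_eq:
  assumes "borel_prob \<T> M"
  shows "space M = topspace \<T>"
  using sets_eq_imp_space_eq[of M "sigma (topspace \<T>) {U. openin \<T> U}"] assms
  by (simp add: borel_prob_def space_measure_of_conv)

lemma borel_prob_openin_sets:
  assumes "borel_prob \<T> M" and "openin \<T> U"
  shows "U \<in> sets M"
  using assms by (auto simp: borel_prob_def intro!: in_measure_of dest: openin_subset)

lemma funpow_shift: "(shift ^^ i) x n = x (n + int i)"
  by (induction i arbitrary: n) (auto simp: shift_def algebra_simps)

lemma factor_Suc: "factor x 0 (int (Suc i)) = factor x 0 (int i) @ [x (int i)]"
  using upto_rec2[of 0 "int i"] by (simp add: factor_def)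

section \<open>Iterates of the skew product map\<close>

locale shift_cocycle = group G for G :: "('g, 'm) monoid_scheme" (structure) +
  fixes A :: "'a set" and X :: "(int \<Rightarrow> 'a) set" and \<phi> :: "'a list \<Rightarrow> 'g"
  assumes finite_carrier: "finite (carrier G)"
    and X: "shift_space A X"
    and hom: "\<phi> \<in> hom (word_monoid A) G"
    and hom_Nil: "\<phi> [] = \<one>"
begin

lemma topspace_shift: "topspace (shift_topology A X) = X"
  using X closedin_subset[of "full_shift A" X]
  by (auto simp: shift_space_def shift_topology_def)

lemma letter_in: "x \<in> X \<Longrightarrow> x n \<in> A"
  using X closedin_subset[of "full_shift A" X]
  by (auto simp: shift_space_def full_shift_def PiE_iff)

lemma shift_in: "x \<in> X \<Longrightarrow> shift x \<in> X"
  using X by (auto simp: shift_space_def)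

lemma funpow_shift_in: "x \<in> X \<Longrightarrow> (shift ^^ i) x \<in> X"
  by (induction i) (auto simp: shift_in)

lemma hom_append: "u \<in> lists A \<Longrightarrow> v \<in> lists A \<Longrightarrow> \<phi> (u @ v) = \<phi> u \<otimes> \<phi> v"
  using hom_mult[OF hom] by (simp add: word_monoid_def)

lemma hom_word_closed: "u \<in> lists A \<Longrightarrow> \<phi> u \<in> carrier G"
  using hom by (auto simp: hom_def word_monoid_def Pi_iff)

lemma factor_in: "x \<in> X \<Longrightarrow> factor x i j \<in> lists A"
  by (auto simp: factor_def letter_in)

lemma letter_closed: "x \<in> X \<Longrightarrow> \<phi> [x n] \<in> carrier G"
  by (intro hom_word_closed) (simp add: letter_in)

lemma skew_map_Pair: "skew_map G \<phi> (g, x) = (g \<otimes> \<phi> [x 0], shift x)"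
  by (simp add: skew_map_def)

lemma funpow_skew_map:
  assumes g: "g \<in> carrier G" and x: "x \<in> X"
  shows "(skew_map G \<phi> ^^ i) (g, x) = (g \<otimes> \<phi> (factor x 0 (int i)), (shift ^^ i) x)"
proof (induction i)
  case 0
  then show ?case using g by (simp add: factor_def hom_Nil)
next
  case (Suc i)
  have "g \<otimes> \<phi> (factor x 0 (int (Suc i))) = g \<otimes> \<phi> (factor x 0 (int i)) \<otimes> \<phi> [x (int i)]"
    unfolding factor_Suc using g x
    by (simp add: hom_append factor_in letter_in m_assoc hom_word_closed letter_closed)
  moreover have "(shift ^^ i) x 0 = x (int i)" by (simp add: funpow_shift)
  ultimately show ?case using Suc by (simp add: skew_map_Pair del: of_nat_Suc)
qed

text \<open>An orbit starting over \<open>g\<close> is over \<open>g\<close> times the image of the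
  word read so far. By left cancellation this lies in \<open>g <# K\<close> exactly when the image
  lies in \<open>K\<close>, so the slice is the same cylinder for every \<open>g\<close>.\<close>

lemma fibre_preimage_coset:
  assumes g: "g \<in> carrier G" and K: "K \<subseteq> carrier G"
  shows "({g} \<times> X) \<inter> ((skew_map G \<phi> ^^ i) -` ((g <# K) \<times> X) \<inter> carrier G \<times> X)
    = {g} \<times> lang_cylinder X (group_language A \<phi> K) i"
proof -
  have "g \<otimes> w \<in> g <# K \<longleftrightarrow> w \<in> K" if "w \<in> carrier G" for w
    using that g K by (auto simp: l_coset_def)
  moreover have "lang_cylinder X (group_language A \<phi> K) i = {x \<in> X. \<phi> (factor x 0 (int i)) \<in> K}"
    by (simp add: lang_cylinder_def group_language_def factor_in del: in_lists_conv_set cong: conj_cong)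
  ultimately show ?thesis using g
    by (auto simp: funpow_skew_map funpow_shift_in hom_word_closed factor_in)
qed

end

section \<open>Counting measure times \<open>\<mu>\<close>, and the density\<close>

locale invariant_shift_cocycle = shift_cocycle G A X \<phi>
  for G :: "('g, 'm) monoid_scheme" (structure) and A :: "'a set" and X \<phi> +
  fixes \<mu> :: "(int \<Rightarrow> 'a) measure"
  assumes inv: "invariant_prob (shift_topology A X) shift \<mu>"
begin

sublocale base: measure_preserving \<mu> shift
  by (rule invariant_prob_measure_preserving[OF inv])

lemma borel_prob_base: "borel_prob (shift_topology A X) \<mu>"
  using inv by (simp add: invariant_prob_def)

lemma space_base: "space \<mu> = X"
  using borel_prob_space_eq[OF borel_prob_base] by (simp add: topspace_shift)

text \<open>The coordinate map is continuous into a discrete space, so preimages of sets of letters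
  are open and hence Borel.\<close>

lemma letter_measurable: "(\<lambda>x. x 0) \<in> \<mu> \<rightarrow>\<^sub>M count_space A"
proof (rule measurableI)
  show "x 0 \<in> space (count_space A)" if "x \<in> space \<mu>" for x
    using that by (simp add: space_base letter_in)
  fix B assume "B \<in> sets (count_space A)"
  then have "openin (discrete_topology A) B" by simp
  moreover have "continuous_map (full_shift A) (discrete_topology A) (\<lambda>x. x 0)"
    unfolding full_shift_def by (rule continuous_map_product_projection) simp
  then have "continuous_map (shift_topology A X) (discrete_topology A) (\<lambda>x. x 0)"
    unfolding shift_topology_def by (rule continuous_map_from_subtopology)
  ultimately have "openin (shift_topology A X) {x \<in> topspace (shift_topology A X). x 0 \<in> B}"
    by (intro openin_continuous_map_preimage)
  from borel_prob_openin_sets[OF borel_prob_base this]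
  show "(\<lambda>x. x 0) -` B \<inter> space \<mu> \<in> sets \<mu>"
    by (simp add: topspace_shift space_base vimage_def Int_def conj_commute)
qed

text \<open>Left unnormalised: the total mass is the order of the group, and each slice over a
  single group element carries exactly \<open>\<mu>\<close>.\<close>

definition lift :: "('g \<times> (int \<Rightarrow> 'a)) measure" where
  "lift = count_space (carrier G) \<Otimes>\<^sub>M \<mu>"

lemma space_lift: "space lift = carrier G \<times> X"
  by (simp add: lift_def space_pair_measure space_base)

lemma skew_map_measurable: "skew_map G \<phi> \<in> lift \<rightarrow>\<^sub>M lift"
  unfolding lift_def
proof (rule measurable_pair_measure_countable1)
  show "countable (carrier G)" by (rule countable_finite[OF finite_carrier])
  fix g assume g: "g \<in> carrier G"
  have "(\<lambda>a. g \<otimes> \<phi> [a]) \<in> count_space A \<rightarrow>\<^sub>M count_space (carrier G)"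
    using g by (auto intro!: m_closed hom_word_closed)
  from measurable_compose[OF letter_measurable this]
  have "(\<lambda>x. (g \<otimes> \<phi> [x 0], shift x)) \<in> \<mu> \<rightarrow>\<^sub>M count_space (carrier G) \<Otimes>\<^sub>M \<mu>"
    by (intro measurable_Pair base.T_measurable)
  then show "(\<lambda>x. skew_map G \<phi> (g, x)) \<in> \<mu> \<rightarrow>\<^sub>M count_space (carrier G) \<Otimes>\<^sub>M \<mu>"
    by (simp add: skew_map_def)
qed

text \<open>Over a fixed \<open>x\<close> the skew map is right multiplication by
  \<open>\<phi> [x 0]\<close>, a bijection of the group, so it preserves the counting measure of
  fibres.\<close>

lemma emeasure_fibre_skew_map:
  assumes Q: "Q \<in> sets lift" and x: "x \<in> X"
  shows "emeasure (count_space (carrier G)) ((\<lambda>g. (g, x)) -` (skew_map G \<phi> -` Q \<inter> space lift))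
    = emeasure (count_space (carrier G)) ((\<lambda>g. (g, shift x)) -` Q)"
proof -
  let ?c = "\<phi> [x 0]"
  let ?S = "(\<lambda>g. (g, x)) -` (skew_map G \<phi> -` Q \<inter> space lift)"
  let ?S' = "(\<lambda>g. (g, shift x)) -` Q"
  have c: "?c \<in> carrier G" using x by (rule letter_closed)
  have Q': "Q \<subseteq> carrier G \<times> X" using sets.sets_into_space[OF Q] by (simp add: space_lift)
  have S: "?S = {g \<in> carrier G. (g \<otimes> ?c, shift x) \<in> Q}"
    using x by (auto simp: space_lift skew_map_def)
  have sub: "?S \<subseteq> carrier G" "?S' \<subseteq> carrier G" using S Q' by auto
  have "bij_betw (\<lambda>g. g \<otimes> ?c) ?S ?S'"
    by (rule bij_betw_byWitness[where f'="\<lambda>h. h \<otimes> inv ?c"])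
      (unfold S, use c Q' in \<open>auto simp: m_assoc\<close>)
  then have "card ?S = card ?S'" by (rule bij_betw_same_card)
  then show ?thesis
    using sub finite_carrier by (simp add: emeasure_count_space finite_subset del: vimage_Int)
qed

lemma sigma_finite_base: "sigma_finite_measure \<mu>"
  by unfold_locales

lemma sigma_finite_fibre: "sigma_finite_measure (count_space (carrier G))"
  by (rule sigma_finite_measure_count_space_finite[OF finite_carrier])

text \<open>Integrating fibre counts over the base reduces invariance to two facts: the fibre count
  of the preimage over \<open>x\<close> is that of \<open>Q\<close> over \<open>shift x\<close>, and
  \<open>\<mu>\<close> is shift-invariant.\<close>

lemma distr_skew_map: "distr lift lift (skew_map G \<phi>) = lift"
proof (rule measure_eqI)
  interpret P: pair_sigma_finite "count_space (carrier G)" \<mu>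
    using sigma_finite_base sigma_finite_fibre by (simp add: pair_sigma_finite_def)
  fix Q assume "Q \<in> sets (distr lift lift (skew_map G \<phi>))"
  then have Q: "Q \<in> sets lift" by simp
  let ?Q = "skew_map G \<phi> -` Q \<inter> space lift"
  have Q': "?Q \<in> sets lift" by (rule measurable_sets[OF skew_map_measurable Q])
  let ?h = "\<lambda>x. emeasure (count_space (carrier G)) ((\<lambda>g. (g, x)) -` Q)"
  have h: "?h \<in> borel_measurable \<mu>"
    using Q P.measurable_emeasure_Pair2[of Q] by (simp add: lift_def)
  have "emeasure (distr lift lift (skew_map G \<phi>)) Q = emeasure lift ?Q"
    by (rule emeasure_distr[OF skew_map_measurable Q])
  also have "\<dots> = (\<integral>\<^sup>+x. emeasure (count_space (carrier G)) ((\<lambda>g. (g, x)) -` ?Q) \<partial>\<mu>)"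
    using P.emeasure_pair_measure_alt2[of ?Q] Q' unfolding lift_def by blast
  also have "\<dots> = (\<integral>\<^sup>+x. ?h (shift x) \<partial>\<mu>)"
    using emeasure_fibre_skew_map[OF Q] by (intro nn_integral_cong) (simp add: space_base)
  also have "\<dots> = (\<integral>\<^sup>+x. ?h x \<partial>distr \<mu> \<mu> shift)"
    by (rule nn_integral_distr[symmetric]) (use h in auto)
  also have "\<dots> = emeasure lift Q"
    using P.emeasure_pair_measure_alt2[of Q] Q unfolding lift_def base.distr_T by simp
  finally show "emeasure (distr lift lift (skew_map G \<phi>)) Q = emeasure lift Q" .
qed simp

lemma emeasure_lift_Times:
  "H \<subseteq> carrier G \<Longrightarrow> C \<in> sets \<mu> \<Longrightarrow> emeasure lift (H \<times> C) = of_nat (card H) * emeasure \<mu> C"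
  using sigma_finite_measure.emeasure_pair_measure_Times[OF sigma_finite_base,
      of H "count_space (carrier G)" C] finite_carrier
  by (simp add: lift_def emeasure_count_space finite_subset)

sublocale lift: measure_preserving lift "skew_map G \<phi>"
proof -
  have "emeasure lift (space lift) = of_nat (card (carrier G)) * emeasure \<mu> X"
    unfolding space_lift using emeasure_lift_Times[of "carrier G" X] sets.top[of \<mu>]
    by (simp add: space_base)
  then have "finite_measure lift"
    by (intro finite_measureI) (simp add: ennreal_mult_eq_top_iff base.emeasure_finite)
  then show "measure_preserving lift (skew_map G \<phi>)"
    using skew_map_measurable distr_skew_map
    by (simp add: measure_preserving_def measure_preserving_axioms_def)
qed

lemma Times_X_in_lift: "H \<subseteq> carrier G \<Longrightarrow> H \<times> X \<in> sets lift"
  unfolding lift_def using sets.top[of \<mu>] by (intro pair_measureI) (auto simp: space_base)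

text \<open>Read off as the section over the identity of a set already known to be measurable in
  \<open>lift\<close>.\<close>

lemma lang_cylinder_in_sets:
  assumes K: "K \<subseteq> carrier G"
  shows "lang_cylinder X (group_language A \<phi> K) i \<in> sets \<mu>"
proof -
  have "({\<one>} \<times> X) \<inter> ((skew_map G \<phi> ^^ i) -` ((\<one> <# K) \<times> X) \<inter> space lift) \<in> sets lift"
    using K by (intro sets.Int Times_X_in_lift measurable_sets[OF lift.funpow_measurable] l_coset_subset_G) auto
  then have "{\<one>} \<times> lang_cylinder X (group_language A \<phi> K) i \<in> sets lift"
    using K by (simp add: space_lift fibre_preimage_coset)
  from sets_Pair1[OF this[unfolded lift_def], of \<one>] show ?thesis by simp
qed

text \<open>Orbits start over the identity because that slice has mass 1 and reproduces
  \<open>\<mu>\<close>. Existence of the density thus follows from convergence of correlations, with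
  no ergodicity assumed.\<close>

lemma density_seq_eq_correlation_avg:
  assumes K: "K \<subseteq> carrier G"
  shows "density_seq X \<mu> (group_language A \<phi> K) = lift.correlation_avg ({\<one>} \<times> X) ((\<one> <# K) \<times> X)"
proof
  fix n
  have "measure lift ({\<one>} \<times> lang_cylinder X (group_language A \<phi> K) i)
      = measure \<mu> (lang_cylinder X (group_language A \<phi> K) i)" for i
    using emeasure_lift_Times[of "{\<one>}"] lang_cylinder_in_sets[OF K] by (simp add: measure_def)
  then show "density_seq X \<mu> (group_language A \<phi> K) n
      = lift.correlation_avg ({\<one>} \<times> X) ((\<one> <# K) \<times> X) n"
    using K by (simp add: density_seq_def lift.correlation_avg_def space_lift fibre_preimage_coset)
qed

lemma density_convergent:
  assumes "K \<subseteq> carrier G"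
  shows "convergent (density_seq X \<mu> (group_language A \<phi> K))"
  unfolding density_seq_eq_correlation_avg[OF assms] using assms
  by (intro lift.correlation_avg_convergent Times_X_in_lift l_coset_subset_G) auto

text \<open>Projection to \<open>\<mu>\<close> splits the measure of each cylinder into its slices
  over the group elements. The slice over \<open>g\<close> is a correlation of
  \<open>{g} \<times> X\<close> with \<open>(g <# K) \<times> X\<close>, so after interchanging
  finite sums each \<open>g\<close> contributes one correlation average, which tends to a product of
  measures.\<close>

lemma density_ergodic:
  assumes K: "K \<subseteq> carrier G"
    and erg: "ergodic_prob (skew_topology G A X) (skew_map G \<phi>) \<nu>" and proj: "projects_to G \<nu> \<mu>"
  shows "density_seq X \<mu> (group_language A \<phi> K)
    \<longlonglongrightarrow> (\<Sum>g\<in>carrier G. measure \<nu> ({g} \<times> X) * measure \<nu> ((g <# K) \<times> X))"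
proof -
  interpret N: ergodic_measure_preserving \<nu> "skew_map G \<phi>"
    by (rule ergodic_prob_ergodic_measure_preserving[OF erg])
  have bp: "borel_prob (skew_topology G A X) \<nu>"
    using erg by (simp add: ergodic_prob_def invariant_prob_def)
  have space_N: "space \<nu> = carrier G \<times> X"
    using borel_prob_space_eq[OF bp] by (simp add: skew_topology_def topspace_shift)
  \<comment> \<open>The group is discrete, so these sets are open and directly Borel, without
    identifying the Borel sets with a product sigma-algebra.\<close>
  have sets_N: "H \<times> X \<in> sets \<nu>" if "H \<subseteq> carrier G" for H
  proof (rule borel_prob_openin_sets[OF bp])
    have "openin (shift_topology A X) X"
      using openin_topspace[of "shift_topology A X"] by (simp add: topspace_shift)
    then show "openin (skew_topology G A X) (H \<times> X)"
      using that by (simp add: skew_topology_def openin_prod_Times_iff)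
  qed
  let ?C = "lang_cylinder X (group_language A \<phi> K)"
  have fibre: "({g} \<times> X) \<inter> ((skew_map G \<phi> ^^ i) -` ((g <# K) \<times> X) \<inter> space \<nu>) = {g} \<times> ?C i"
    if "g \<in> carrier G" for g i
    using fibre_preimage_coset[OF that K] by (simp add: space_N)
  have fibre_sets: "{g} \<times> ?C i \<in> sets \<nu>" if "g \<in> carrier G" for g i
    unfolding fibre[OF that, symmetric] using that K
    by (intro sets.Int sets_N measurable_sets[OF N.funpow_measurable] l_coset_subset_G) auto
  have "measure \<mu> (?C i) = (\<Sum>g\<in>carrier G. measure \<nu> ({g} \<times> ?C i))" for i
  proof -
    have "measure \<mu> (?C i) = measure \<nu> (carrier G \<times> ?C i)"
      using proj lang_cylinder_in_sets[OF K] by (simp add: projects_to_def)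
    also have "carrier G \<times> ?C i = (\<Union>g\<in>carrier G. {g} \<times> ?C i)" by auto
    also have "measure \<nu> \<dots> = (\<Sum>g\<in>carrier G. measure \<nu> ({g} \<times> ?C i))"
      by (rule N.finite_measure_finite_Union[OF finite_carrier])
        (use fibre_sets in \<open>auto simp: disjoint_family_on_def\<close>)
    finally show ?thesis .
  qed
  then have "density_seq X \<mu> (group_language A \<phi> K) n
      = (\<Sum>g\<in>carrier G. N.correlation_avg ({g} \<times> X) ((g <# K) \<times> X) n)" for n
    unfolding density_seq_def N.correlation_avg_def
    by (simp add: fibre sum.swap[of _ "{..<n}"] flip: sum_divide_distrib)
  then have "density_seq X \<mu> (group_language A \<phi> K)
      = (\<lambda>n. \<Sum>g\<in>carrier G. N.correlation_avg ({g} \<times> X) ((g <# K) \<times> X) n)" ..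
  then show ?thesis using K
    by (auto intro!: tendsto_sum N.correlation_avg_ergodic sets_N simp: l_coset_subset_G[THEN subsetD])
qed

end

theorem theorem1p1:
  fixes A :: "'a set" and X :: "(int \<Rightarrow> 'a) set" and \<mu> :: "(int \<Rightarrow> 'a) measure"
    and G :: "('g, 'm) monoid_scheme" and \<phi> :: "'a list \<Rightarrow> 'g" and K :: "'g set"
  assumes "finite A"
    and "shift_space A X"
    and "invariant_prob (shift_topology A X) shift \<mu>"
    and "group G" and "finite (carrier G)"
    and "\<phi> \<in> hom (word_monoid A) G" and "\<phi> [] = \<one>\<^bsub>G\<^esub>"
    and "\<phi> ` lists A = carrier G"
    and "K \<subseteq> carrier G"
  shows "density_exists X \<mu> (group_language A \<phi> K) \<and>
    (ergodic_prob (shift_topology A X) shift \<mu> \<longrightarrow>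
      (\<forall>\<nu> :: ('g \<times> (int \<Rightarrow> 'a)) measure.
        ergodic_prob (skew_topology G A X) (skew_map G \<phi>) \<nu> \<and> projects_to G \<nu> \<mu> \<longrightarrow>
        lang_density X \<mu> (group_language A \<phi> K) =
          (\<Sum>g\<in>carrier G. measure \<nu> ({g} \<times> X) * measure \<nu> ((g <#\<^bsub>G\<^esub> K) \<times> X))))"
proof -
  interpret group G by fact
  interpret invariant_shift_cocycle G A X \<phi> \<mu>
    using assms by unfold_locales auto
  show ?thesis
    using density_convergent[OF assms(9)] density_ergodic[OF assms(9)]
    by (auto simp: density_exists_def lang_density_def intro!: limI)
qed

end
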